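(* Let $\mathbb{F}$ be a field, $d\ge3$ an integer, and $V$ a vector space over $\mathbb{F}$ of dimension $d+1$. Let $\beta\in\mathbb{F}$ and let $\Phi=(A;\{E_i\}_{i=0}^d;A^*;\{E^*_i\}_{i=0}^d)$ be a CH system on $V$. Then the following (i), (ii) are equivalent: (i) $\Phi$ is $\beta$-recurrent. (ii) There exist scalars $\gamma,\gamma^*,\varrho,\varrho^*\in\mathbb{F}$ such that both $$0=[A,\;A^2A^*-\beta AA^*A+A^*A^2-\gamma(AA^*+A^*A)-\varrho A^*],$$ $$0=[A^*,\;A^{*2}A-\beta A^*AA^*+AA^{*2}-\gamma^*(A^*A+AA^* )-\varrho^*A],$$ where $[r,s]=rs-sr$.
   Context: Rows and columns of $(d+1)\times(d+1)$ matrices are indexed by $0,\dots,d$. A matrix $M$ represents $B\in\mathrm{End}(V)$ with respect to a basis $\{v_i\}_{i=0}^d$ if $Bv_j=\sum_iM_{ij}v_i$. An element of $\mathrm{End}(V)$ is multiplicity-free if it is diagonalizable with all eigenspaces of dimension one. The primitive idempotent of a multiplicity-free $B$ for an eigenvalue $\theta$ is the $E\in\mathrm{End}(V)$ acting as the identity on the $\theta$-eigenspace and as $0$ on the other eigenspaces. A CH system on $V$ is a sequence $\Phi=(A;\{E_i\}_{i=0}^d;A^*;\{E^*_i\}_{i=0}^d)$ in $\mathrm{End}(V)$ such that: (i) $A,A^*$ are multiplicity-free; (ii) $\{E_i\}$ is an ordering of the primitive idempotents of $A$; (iii) $\{E^*_i\}$ is an ordering of the primitive idempotents of $A^*$; (iv)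 $E_iA^*E_j=0$ if $1<i-j$ or $1<j-i<d$, and $E_iA^*E_j\neq0$ if $i-j=1$ or $j-i=d$; (v) $E^*_iAE^*_j=0$ if $1<i-j$ or $1<j-i<d$, and $E^*_iAE^*_j\neq0$ if $i-j=1$ or $j-i=d$ $(0\le i,j\le d)$. Let $\theta_i$ (resp. $\theta^*_i$) be the eigenvalue of $A$ (resp. $A^*$) corresponding to $E_i$ (resp. $E^*_i$). It is known that there is a unique sequence $\{\phi_i\}_{i=1}^d$ of nonzero scalars (the $\Phi$-split sequence) such that for some basis of $V$, $A$ is represented by the lower bidiagonal matrix with $(i,i)$-entry $\theta_{d-i}$ and $(i,i-1)$-entry $1$, and $A^*$ by the upper bidiagonal matrix with $(i,i)$-entry $\theta^*_i$ and $(i-1,i)$-entry $\phi_i$ (all other entries $0$). Put $\vartheta_0=\vartheta_{d+1}=0$ and $\vartheta_i=\phi_i-(\theta^*_i-\theta^*_0)(\theta_{d-i+1}-\theta_0)$ for $1\le i\le d$. A sequence $\{\sigma_i\}_{i=0}^n$ in $\mathbb{F}$ is $\beta$-recurrent if $\sigma_{i-2}-(\beta+1)\sigma_{i-1}+(\beta+1)\sigma_i-\sigma_{i+1}=0$ for $2\le i\le n-1$. The CH system $\Phi$ is $\beta$-recurrent if $\{\theta_i\}_{i=0}^d$, $\{\theta^*_i\}_{i=0}^d$ and $\{\vartheta_i\}_{i=0}^{d+1}$ are all $\beta$-recurrent. *)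

theory Defs
  imports "HOL.Vector_Spaces"
begin

text \<open>
  The vector space \<open>V\<close> is the whole type \<open>'b\<close>, with scalar multiplication \<open>scale\<close>;
  elements of \<open>End(V)\<close> are the maps that are linear from \<open>scale\<close> to \<open>scale\<close>.  A sequence
  indexed by \<open>0, \<dots>, n\<close> is a function on \<open>nat\<close> of which only the values at \<open>0, \<dots>, n\<close> matter, and
  similarly for matrices.
\<close>

definition beta_recurrent_seq :: "'a::field \<Rightarrow> nat \<Rightarrow> (nat \<Rightarrow> 'a) \<Rightarrow> bool" where
  "beta_recurrent_seq \<beta> n \<sigma> \<longleftrightarrow>
     (\<forall>i. 2 \<le> i \<and> i < n \<longrightarrow>
        \<sigma> (i - 2) - (\<beta> + 1) * \<sigma> (i - 1) + (\<beta> + 1) * \<sigma> i - \<sigma> (i + 1) = 0)"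

definition commutator :: "('b \<Rightarrow> 'b) \<Rightarrow> ('b \<Rightarrow> 'b) \<Rightarrow> 'b \<Rightarrow> 'b::ab_group_add" where
  "commutator r s = (\<lambda>v. r (s v) - s (r v))"

context vector_space
begin

definition endo :: "('b \<Rightarrow> 'b) \<Rightarrow> bool" where
  "endo B \<longleftrightarrow> Vector_Spaces.linear scale scale B"

definition eigenspace :: "('b \<Rightarrow> 'b) \<Rightarrow> 'a \<Rightarrow> 'b set" where
  "eigenspace B \<theta> = {v. B v = \<theta> *s v}"

definition eigenvalue :: "('b \<Rightarrow> 'b) \<Rightarrow> 'a \<Rightarrow> bool" where
  "eigenvalue B \<theta> \<longleftrightarrow> (\<exists>v. v \<noteq> 0 \<and> B v = \<theta> *s v)"

definition diagonalizable :: "('b \<Rightarrow> 'b) \<Rightarrow> bool" where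
  "diagonalizable B \<longleftrightarrow>
     (\<exists>S. independent S \<and> span S = UNIV \<and> (\<forall>v\<in>S. \<exists>\<theta>. v \<in> eigenspace B \<theta>))"

definition multiplicity_free :: "('b \<Rightarrow> 'b) \<Rightarrow> bool" where
  "multiplicity_free B \<longleftrightarrow>
     endo B \<and> diagonalizable B \<and> (\<forall>\<theta>. eigenvalue B \<theta> \<longrightarrow> dim (eigenspace B \<theta>) = 1)"

definition primitive_idempotent :: "('b \<Rightarrow> 'b) \<Rightarrow> 'a \<Rightarrow> ('b \<Rightarrow> 'b) \<Rightarrow> bool" where
  "primitive_idempotent B \<theta> E \<longleftrightarrow>
     eigenvalue B \<theta> \<and> endo E \<and>
     (\<forall>v \<in> eigenspace B \<theta>. E v = v) \<and>
     (\<forall>\<mu>. \<mu> \<noteq> \<theta> \<longrightarrow> (\<forall>v \<in> eigenspace B \<mu>. E v = 0))"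

definition idempotent_ordering :: "nat \<Rightarrow> ('b \<Rightarrow> 'b) \<Rightarrow> (nat \<Rightarrow> 'b \<Rightarrow> 'b) \<Rightarrow> bool" where
  "idempotent_ordering d B E \<longleftrightarrow>
     bij_betw E {0..d} {F. \<exists>\<theta>. primitive_idempotent B \<theta> F}"

text \<open>
  The conditions relating a map \<open>B\<close> to an idempotent sequence \<open>E\<close> that occur, with the two pairs
  interchanged, as the last two axioms of a CH system.  Index differences are taken in the integers.
\<close>

definition circular_Hessenberg :: "nat \<Rightarrow> (nat \<Rightarrow> 'b \<Rightarrow> 'b) \<Rightarrow> ('b \<Rightarrow> 'b) \<Rightarrow> bool" where
  "circular_Hessenberg d E B \<longleftrightarrow>
     (\<forall>i\<in>{0..d}. \<forall>j\<in>{0..d}.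
        (1 < int i - int j \<or> (1 < int j - int i \<and> int j - int i < int d)
           \<longrightarrow> E i \<circ> B \<circ> E j = (\<lambda>v. 0)) \<and>
        (int i - int j = 1 \<or> int j - int i = int d
           \<longrightarrow> E i \<circ> B \<circ> E j \<noteq> (\<lambda>v. 0)))"

definition CH_system ::
  "nat \<Rightarrow> ('b \<Rightarrow> 'b) \<Rightarrow> (nat \<Rightarrow> 'b \<Rightarrow> 'b) \<Rightarrow> ('b \<Rightarrow> 'b) \<Rightarrow> (nat \<Rightarrow> 'b \<Rightarrow> 'b) \<Rightarrow> bool" where
  "CH_system d A E As Es \<longleftrightarrow>
     multiplicity_free A \<and> multiplicity_free As \<and>
     idempotent_ordering d A E \<and>
     idempotent_ordering d As Es \<and>
     circular_Hessenberg d E As \<and>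
     circular_Hessenberg d Es A"

definition eigenvalue_seq :: "('b \<Rightarrow> 'b) \<Rightarrow> (nat \<Rightarrow> 'b \<Rightarrow> 'b) \<Rightarrow> nat \<Rightarrow> 'a" where
  "eigenvalue_seq B E i = (THE \<theta>. primitive_idempotent B \<theta> (E i))"

definition is_basis :: "nat \<Rightarrow> (nat \<Rightarrow> 'b) \<Rightarrow> bool" where
  "is_basis d v \<longleftrightarrow>
     inj_on v {0..d} \<and> independent (v ` {0..d}) \<and> span (v ` {0..d}) = UNIV"

definition represents :: "nat \<Rightarrow> (nat \<Rightarrow> 'b) \<Rightarrow> (nat \<Rightarrow> nat \<Rightarrow> 'a) \<Rightarrow> ('b \<Rightarrow> 'b) \<Rightarrow> bool" where
  "represents d v M B \<longleftrightarrow> (\<forall>j\<in>{0..d}. B (v j) = (\<Sum>i=0..d. M i j *s v i))"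

definition is_split_seq ::
  "nat \<Rightarrow> ('b \<Rightarrow> 'b) \<Rightarrow> (nat \<Rightarrow> 'b \<Rightarrow> 'b) \<Rightarrow> ('b \<Rightarrow> 'b) \<Rightarrow> (nat \<Rightarrow> 'b \<Rightarrow> 'b) \<Rightarrow> (nat \<Rightarrow> 'a) \<Rightarrow> bool" where
  "is_split_seq d A E As Es \<phi> \<longleftrightarrow>
     (\<forall>i\<in>{1..d}. \<phi> i \<noteq> 0) \<and>
     (\<exists>v. is_basis d v \<and>
        represents d v
          (\<lambda>i j. if i = j then eigenvalue_seq A E (d - i) else if i = j + 1 then 1 else 0) A \<and>
        represents d v
          (\<lambda>i j. if i = j then eigenvalue_seq As Es i else if j = i + 1 then \<phi> j else 0) As)"

text \<open>
  The split sequence is unique only on \<open>{1..d}\<close>; requiring the value \<open>0\<close> elsewhere makes it unique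
  as a function on \<open>nat\<close>.
\<close>

definition split_seq ::
  "nat \<Rightarrow> ('b \<Rightarrow> 'b) \<Rightarrow> (nat \<Rightarrow> 'b \<Rightarrow> 'b) \<Rightarrow> ('b \<Rightarrow> 'b) \<Rightarrow> (nat \<Rightarrow> 'b \<Rightarrow> 'b) \<Rightarrow> nat \<Rightarrow> 'a" where
  "split_seq d A E As Es =
     (THE \<phi>. is_split_seq d A E As Es \<phi> \<and> (\<forall>i. i \<notin> {1..d} \<longrightarrow> \<phi> i = 0))"

definition vartheta_seq ::
  "nat \<Rightarrow> ('b \<Rightarrow> 'b) \<Rightarrow> (nat \<Rightarrow> 'b \<Rightarrow> 'b) \<Rightarrow> ('b \<Rightarrow> 'b) \<Rightarrow> (nat \<Rightarrow> 'b \<Rightarrow> 'b) \<Rightarrow> nat \<Rightarrow> 'a" where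
  "vartheta_seq d A E As Es i =
     (if 1 \<le> i \<and> i \<le> d
      then split_seq d A E As Es i
           - (eigenvalue_seq As Es i - eigenvalue_seq As Es 0)
             * (eigenvalue_seq A E (d - i + 1) - eigenvalue_seq A E 0)
      else 0)"

definition beta_recurrent ::
  "'a \<Rightarrow> nat \<Rightarrow> ('b \<Rightarrow> 'b) \<Rightarrow> (nat \<Rightarrow> 'b \<Rightarrow> 'b) \<Rightarrow> ('b \<Rightarrow> 'b) \<Rightarrow> (nat \<Rightarrow> 'b \<Rightarrow> 'b) \<Rightarrow> bool" where
  "beta_recurrent \<beta> d A E As Es \<longleftrightarrow>
     beta_recurrent_seq \<beta> d (eigenvalue_seq A E) \<and>
     beta_recurrent_seq \<beta> d (eigenvalue_seq As Es) \<and>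
     beta_recurrent_seq \<beta> (d + 1) (vartheta_seq d A E As Es)"

end

end

theory Submission
  imports Defs
begin

text \<open>
  Write \<open>D\<close> for the first commutator and \<open>P\<close> for the polynomial
  \<open>x\<^sup>2 - \<beta> x y + y\<^sup>2 - \<gamma> (x + y) - \<rho>\<close> (\<open>td_poly\<close>).  Then
  \<open>E\<^sub>i D E\<^sub>j = (\<theta>\<^sub>i - \<theta>\<^sub>j) P(\<theta>\<^sub>i, \<theta>\<^sub>j) E\<^sub>i A* E\<^sub>j\<close>, and similarly for the second commutator.
  For suitable \<open>\<gamma>\<close> and \<open>\<rho>\<close>, recurrence of \<open>\<theta>\<close> is equivalent to \<open>P(\<theta>\<^sub>i, \<theta>\<^sub>i\<^sub>-\<^sub>1) = 0\<close> for
  \<open>1 \<le> i \<le> d\<close>.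

  If \<open>\<theta>\<close> and \<open>\<theta>*\<close> are recurrent, then only the corner \<open>E\<^sub>0 D E\<^sub>d\<close> can survive; in the split basis
  \<open>v\<^sub>0, \<dots>, v\<^sub>d\<close> it is the coefficient of \<open>v\<^sub>d\<close> in \<open>D v\<^sub>0\<close>.  Since \<open>D\<close> raises the index by at most
  three, this coefficient vanishes for \<open>d > 3\<close>, and for \<open>d = 3\<close> it is the recurrence for \<open>\<theta>*\<close>.
  The second commutator is dual.  Conversely, if both commutators vanish, then so do the
  values of \<open>P\<close>, and the coefficient of \<open>v\<^sub>i\<^sub>+\<^sub>2\<close> in \<open>D v\<^sub>i = 0\<close> is the recurrence for \<open>\<vartheta>\<close>.
\<close>

section \<open>Linear maps, bases and coordinates\<close>

context vector_space
begin

lemma endoI: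
  assumes "\<And>x y. B (x + y) = B x + B y" "\<And>c x. B (c *s x) = c *s B x"
  shows "endo B"
  using assms vector_space_axioms by (simp add: endo_def linear_iff)

lemma endo_add: "endo B \<Longrightarrow> B (x + y) = B x + B y"
  and endo_scale: "endo B \<Longrightarrow> B (c *s x) = c *s B x"
  by (simp_all add: endo_def linear_iff)

lemma endo_additive: "endo B \<Longrightarrow> additive B"
  by (simp add: additive_def endo_add)

lemma endo_zero: "endo B \<Longrightarrow> B 0 = 0"
  and endo_minus: "endo B \<Longrightarrow> B (- x) = - B x"
  and endo_diff: "endo B \<Longrightarrow> B (x - y) = B x - B y"
  and endo_sum: "endo B \<Longrightarrow> B (sum f I) = (\<Sum>i\<in>I. B (f i))"
  by (simp_all add: additive.zero additive.minus additive.diff additive.sum endo_additive)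

lemmas endo_simps = endo_add endo_scale endo_zero endo_minus endo_diff

lemma endo_eqI:
  assumes "endo F" "endo G" "span S = UNIV" "\<And>x. x \<in> S \<Longrightarrow> F x = G x"
  shows "F = G"
proof
  fix x
  have "x \<in> span S" using assms(3) by simp
  then show "F x = G x"
    by (induction rule: span_induct_alt) (simp_all add: assms endo_simps)
qed

lemma finite_dimensionalI:
  assumes "dim UNIV = Suc d"
  obtains T where "finite_dimensional_vector_space scale T" "dim UNIV = card T"
proof -
  obtain T where T: "independent T" "UNIV \<subseteq> span T" "card T = dim UNIV"
    using basis_exists[of UNIV] by metis
  then have "finite T"
    using assms card_ge_0_finite[of T] by simp
  then have "finite_dimensional_vector_space scale T"
    using T by unfold_locales auto
  with T that show thesis by simp
qed

lemma is_basis_if_independent: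
  assumes "dim UNIV = Suc d" "inj_on v {0..d}" "independent (v ` {0..d})"
  shows "is_basis d v"
proof -
  obtain T where T: "finite_dimensional_vector_space scale T"
    using finite_dimensionalI[OF assms(1)] by blast
  have "UNIV \<subseteq> span (v ` {0..d})"
    by (rule finite_dimensional_vector_space.card_ge_dim_independent[OF T])
      (use assms in \<open>auto simp: card_image\<close>)
  then show ?thesis
    using assms by (auto simp: is_basis_def)
qed

lemma is_basis_if_spanning:
  assumes dim: "dim UNIV = Suc d" and span: "span (v ` {0..d}) = UNIV"
  shows "is_basis d v"
proof -
  obtain T where T: "finite_dimensional_vector_space scale T"
    using finite_dimensionalI[OF dim] by blast
  have le: "card (v ` {0..d}) \<le> Suc d"
    using card_image_le[of "{0..d}" v] by simp
  have ind: "independent (v ` {0..d})"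
    by (rule finite_dimensional_vector_space.card_le_dim_spanning[OF T, of _ UNIV])
      (use le dim span in auto)
  then have "card (v ` {0..d}) = Suc d"
    using dim span dim_span_eq_card_independent by metis
  then have "inj_on v {0..d}"
    by (intro eq_card_imp_inj_on) auto
  with ind span show ?thesis
    by (simp add: is_basis_def)
qed

lemma is_basis_expand:
  assumes "is_basis d v"
  obtains c where "x = (\<Sum>i=0..d. c i *s v i)"
proof -
  have "x \<in> span (v ` {0..d})"
    using assms by (simp add: is_basis_def)
  then obtain u where "x = (\<Sum>y\<in>v ` {0..d}. u y *s y)"
    using span_finite[of "v ` {0..d}"] by auto
  also have "\<dots> = (\<Sum>i=0..d. u (v i) *s v i)"
    using assms by (subst sum.reindex) (simp_all add: is_basis_def)
  finally show thesis by (rule that)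
qed

definition coord :: "nat \<Rightarrow> (nat \<Rightarrow> 'b) \<Rightarrow> nat \<Rightarrow> 'b \<Rightarrow> 'a" where
  "coord d v k x = representation (v ` {0..d}) x (v k)"

lemma coord_add: "is_basis d v \<Longrightarrow> coord d v k (x + y) = coord d v k x + coord d v k y"
  and coord_diff: "is_basis d v \<Longrightarrow> coord d v k (x - y) = coord d v k x - coord d v k y"
  and coord_scale: "is_basis d v \<Longrightarrow> coord d v k (c *s x) = c * coord d v k x"
  and coord_zero: "coord d v k 0 = 0"
  by (simp_all add: coord_def is_basis_def representation_add representation_diff
      representation_scale representation_zero)

lemma coord_basis:
  "is_basis d v \<Longrightarrow> k \<le> d \<Longrightarrow> j \<le> d \<Longrightarrow> coord d v k (v j) = (if k = j then 1 else 0)"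
  by (auto simp: coord_def is_basis_def representation_basis inj_on_eq_iff)

end

section \<open>Spectral decomposition of a multiplicity-free map\<close>

text \<open>\<open>rank_le\<close> and \<open>idem_nonzero\<close> together encode that each
  \<open>E i\<close> has rank one, in a form that compares two images directly.\<close>

locale spectral = vector_space scale
  for scale :: "'a::field \<Rightarrow> 'b::ab_group_add \<Rightarrow> 'b" (infixr "*s" 75) +
  fixes d :: nat and B :: "'b \<Rightarrow> 'b" and E :: "nat \<Rightarrow> 'b \<Rightarrow> 'b" and \<theta> :: "nat \<Rightarrow> 'a"
  assumes endo_map: "endo B"
    and endo_idem: "i \<le> d \<Longrightarrow> endo (E i)"
    and map_idem: "i \<le> d \<Longrightarrow> B (E i x) = \<theta> i *s E i x"
    and idem_idem: "i \<le> d \<Longrightarrow> j \<le> d \<Longrightarrow> E i (E j x) = (if i = j then E i x else 0)"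
    and resolution: "(\<Sum>i=0..d. E i x) = x"
    and distinct: "i \<le> d \<Longrightarrow> j \<le> d \<Longrightarrow> \<theta> i = \<theta> j \<Longrightarrow> i = j"
    and rank_le: "i \<le> d \<Longrightarrow> E i x \<noteq> 0 \<Longrightarrow> \<exists>c. E i y = c *s E i x"
    and idem_nonzero: "i \<le> d \<Longrightarrow> \<exists>x. E i x \<noteq> 0"
begin

lemma idem_map: assumes "i \<le> d" shows "E i (B x) = \<theta> i *s E i x"
proof -
  have "E i (B x) = E i (B (\<Sum>j=0..d. E j x))"
    by (simp add: resolution)
  also have "\<dots> = (\<Sum>j=0..d. E i (\<theta> j *s E j x))"
    using assms by (simp add: endo_sum endo_map endo_idem map_idem)
  also have "\<dots> = (\<Sum>j=0..d. if j = i then \<theta> i *s E i x else 0)"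
    using assms by (intro sum.cong) (auto simp: endo_idem endo_scale idem_idem)
  finally show ?thesis
    using assms by simp
qed

lemma eqI_idem: assumes "\<And>i. i \<le> d \<Longrightarrow> E i x = E i y" shows "x = y"
proof -
  have "(\<Sum>i=0..d. E i x) = (\<Sum>i=0..d. E i y)"
    by (intro sum.cong) (auto simp: assms)
  then show ?thesis by (simp add: resolution)
qed

lemma eq_idemI:
  assumes "k \<le> d" "\<And>i. i \<le> d \<Longrightarrow> i \<noteq> k \<Longrightarrow> E i x = 0"
  shows "x = E k x"
  by (rule eqI_idem) (use assms in \<open>auto simp: idem_idem\<close>)

end

context vector_space
begin

text \<open>One eigenvector per idempotent gives \<open>Suc d\<close> independent vectors, hence a
  basis. On it the \<open>E i\<close> act as Kronecker deltas, which yields the axioms of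
  \<open>spectral\<close>.\<close>

lemma spectral_eigenvalue_seq:
  assumes dim: "dim UNIV = Suc d" and mf: "multiplicity_free B"
    and ord: "idempotent_ordering d B E"
  shows "spectral scale d B E (eigenvalue_seq B E)"
proof -
  have endo: "endo B" using mf by (simp add: multiplicity_free_def)
  have "\<forall>i. \<exists>\<theta>. i \<le> d \<longrightarrow> primitive_idempotent B \<theta> (E i)"
    using ord by (auto simp: idempotent_ordering_def bij_betw_def)
  then obtain \<theta> where \<theta>: "\<And>i. i \<le> d \<Longrightarrow> primitive_idempotent B (\<theta> i) (E i)"
    by metis
  have "\<forall>i. \<exists>w. i \<le> d \<longrightarrow> w \<noteq> 0 \<and> B w = \<theta> i *s w"
    using \<theta> by (auto simp: primitive_idempotent_def eigenvalue_def)
  then obtain w where w: "\<And>i. i \<le> d \<Longrightarrow> w i \<noteq> 0" "\<And>i. i \<le> d \<Longrightarrow> B (w i) = \<theta> i *s w i"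
    by metis
  have endoE: "endo (E i)" if "i \<le> d" for i
    using \<theta>[OF that] by (simp add: primitive_idempotent_def)
  \<comment> \<open>Eigenvectors span the space, so an idempotent is determined by its eigenvalue; a
    repeated eigenvalue would contradict injectivity of the ordering.\<close>
  have distinct: "i = j" if ij: "i \<le> d" "j \<le> d" "\<theta> i = \<theta> j" for i j
  proof -
    obtain S where S: "span S = UNIV" "\<forall>v\<in>S. \<exists>\<mu>. v \<in> eigenspace B \<mu>"
      using mf by (auto simp: multiplicity_free_def diagonalizable_def)
    have "E i = E j"
    proof (rule endo_eqI[OF _ _ S(1)])
      fix x assume "x \<in> S"
      then obtain \<mu> where "x \<in> eigenspace B \<mu>" using S(2) by blast
      then show "E i x = E j x"
        using \<theta>[OF ij(1)] \<theta>[OF ij(2)] ij(3)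
        by (cases "\<mu> = \<theta> i") (auto simp: primitive_idempotent_def)
    qed (use endoE ij in auto)
    moreover have "inj_on E {0..d}"
      using ord by (simp add: idempotent_ordering_def bij_betw_def)
    ultimately show ?thesis
      using ij by (auto dest: inj_onD)
  qed
  have Ew: "E i (w j) = (if i = j then w i else 0)" if "i \<le> d" "j \<le> d" for i j
  proof (cases "i = j")
    case True
    then show ?thesis
      using \<theta>[OF that(1)] w(2)[OF that(2)] by (simp add: primitive_idempotent_def eigenspace_def)
  next
    case False
    then have "\<theta> j \<noteq> \<theta> i" using distinct that by metis
    then show ?thesis
      using False \<theta>[OF that(1)] w(2)[OF that(2)]
      by (simp add: primitive_idempotent_def eigenspace_def)
  qed
  have seq: "eigenvalue_seq B E i = \<theta> i" if i: "i \<le> d" for i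
    unfolding eigenvalue_seq_def
  proof (rule the_equality)
    show "primitive_idempotent B (\<theta> i) (E i)" by (rule \<theta>[OF i])
    fix \<mu> assume \<mu>: "primitive_idempotent B \<mu> (E i)"
    have "w i \<in> eigenspace B (\<theta> i)"
      using w(2)[OF i] by (simp add: eigenspace_def)
    moreover have "E i (w i) \<noteq> 0"
      using Ew[OF i i] w(1)[OF i] by simp
    ultimately show "\<mu> = \<theta> i"
      using \<mu> unfolding primitive_idempotent_def by metis
  qed
  have sumE: "E i (\<Sum>j=0..d. c j *s w j) = c i *s w i" if i: "i \<le> d" for i c
  proof -
    have "E i (\<Sum>j=0..d. c j *s w j) = (\<Sum>j=0..d. if j = i then c i *s w i else 0)"
      unfolding endo_sum[OF endoE[OF i]] using i
      by (intro sum.cong) (auto simp: endo_scale endoE Ew)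
    then show ?thesis using i by simp
  qed
  have inj: "inj_on w {0..d}"
  proof (rule inj_onI)
    fix i j assume "i \<in> {0..d}" "j \<in> {0..d}" "w i = w j"
    then show "i = j"
      using Ew[of i i] Ew[of i j] w(1)[of i] by (cases "i = j") auto
  qed
  have "independent (w ` {0..d})"
  proof (rule independent_if_scalars_zero)
    fix f x assume f: "(\<Sum>x\<in>w ` {0..d}. f x *s x) = 0" and x: "x \<in> w ` {0..d}"
    obtain i where i: "i \<le> d" "x = w i" using x by auto
    have "(\<Sum>j=0..d. f (w j) *s w j) = 0"
      using f inj by (simp add: sum.reindex)
    then have "f (w i) *s w i = 0"
      using sumE[OF i(1), of "\<lambda>j. f (w j)"] by (simp add: endo_zero endoE i)
    then show "f x = 0"
      using i w(1) by simp
  qed simp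
  then have basis: "is_basis d w"
    using dim inj by (intro is_basis_if_independent)
  show ?thesis
  proof
    fix i j x y
    obtain c where c: "x = (\<Sum>j=0..d. c j *s w j)"
      using is_basis_expand[OF basis] by blast
    obtain c' where c': "y = (\<Sum>j=0..d. c' j *s w j)"
      using is_basis_expand[OF basis] by blast
    show "(\<Sum>i=0..d. E i x) = x"
      unfolding c by (rule sum.cong) (simp_all add: sumE)
    assume i: "i \<le> d"
    show "endo (E i)" by (rule endoE[OF i])
    have "E i (w i) \<noteq> 0" using Ew[OF i i] w(1)[OF i] by simp
    then show "\<exists>x. E i x \<noteq> 0" by blast
    show "B (E i x) = eigenvalue_seq B E i *s E i x"
      by (simp add: c sumE i seq w endo_scale endo mult.commute)
    {
      assume "E i x \<noteq> 0"
      then have "E i y = (c' i / c i) *s E i x"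
        by (simp add: c c' sumE i)
      then show "\<exists>r. E i y = r *s E i x" ..
    }
    assume j: "j \<le> d"
    show "E i (E j x) = (if i = j then E i x else 0)"
      by (simp add: c sumE i j endo_scale endoE Ew)
    show "eigenvalue_seq B E i = eigenvalue_seq B E j \<Longrightarrow> i = j"
      using distinct i j by (simp add: seq)
  qed (rule endo)
qed

end

section \<open>Recurrent sequences and zeros of \<open>td_poly\<close>\<close>

definition td_poly :: "'a::field \<Rightarrow> 'a \<Rightarrow> 'a \<Rightarrow> 'a \<Rightarrow> 'a \<Rightarrow> 'a" where
  "td_poly \<beta> \<gamma> \<rho> x y = x * x - \<beta> * x * y + y * y - \<gamma> * (x + y) - \<rho>"

lemma td_poly_commute: "td_poly \<beta> \<gamma> \<rho> x y = td_poly \<beta> \<gamma> \<rho> y x"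
  by (simp add: td_poly_def algebra_simps)

text \<open>By symmetry both values come from one monic quadratic, at \<open>x\<close> and at
  \<open>z\<close>, with \<open>y\<close> fixed. Hence the factor \<open>x - z\<close>; the cofactor
  is the three-term expression minus \<open>\<gamma>\<close>.\<close>

lemma td_poly_diff:
  "td_poly \<beta> \<gamma> \<rho> y x - td_poly \<beta> \<gamma> \<rho> z y = (x - z) * (x - \<beta> * y + z - \<gamma>)"
  by (simp add: td_poly_def algebra_simps)

text \<open>Shifting the index by two removes the truncated subtraction on
  \<open>nat\<close>.\<close>

lemma beta_recurrent_seq_iff:
  "beta_recurrent_seq \<beta> n \<sigma> \<longleftrightarrow>
    (\<forall>i. i + 3 \<le> n \<longrightarrow> \<sigma> i - (\<beta> + 1) * \<sigma> (i + 1) + (\<beta> + 1) * \<sigma> (i + 2) - \<sigma> (i + 3) = 0)"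
proof
  assume L: "beta_recurrent_seq \<beta> n \<sigma>"
  show "\<forall>i. i + 3 \<le> n \<longrightarrow> \<sigma> i - (\<beta> + 1) * \<sigma> (i + 1) + (\<beta> + 1) * \<sigma> (i + 2) - \<sigma> (i + 3) = 0"
  proof (intro allI impI)
    fix i assume "i + 3 \<le> n"
    then show "\<sigma> i - (\<beta> + 1) * \<sigma> (i + 1) + (\<beta> + 1) * \<sigma> (i + 2) - \<sigma> (i + 3) = 0"
      using L[unfolded beta_recurrent_seq_def, rule_format, of "i + 2"]
      by (simp add: eval_nat_numeral)
  qed
next
  assume R: "\<forall>i. i + 3 \<le> n \<longrightarrow> \<sigma> i - (\<beta> + 1) * \<sigma> (i + 1) + (\<beta> + 1) * \<sigma> (i + 2) - \<sigma> (i + 3) = 0"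
  show "beta_recurrent_seq \<beta> n \<sigma>"
    unfolding beta_recurrent_seq_def
  proof (intro allI impI)
    fix i assume "2 \<le> i \<and> i < n"
    moreover then obtain k where "i = k + 2"
      using le_Suc_ex[of 2 i] by auto
    ultimately show "\<sigma> (i - 2) - (\<beta> + 1) * \<sigma> (i - 1) + (\<beta> + 1) * \<sigma> i - \<sigma> (i + 1) = 0"
      using R[rule_format, of k] by (simp add: eval_nat_numeral)
  qed
qed

text \<open>The recurrence is the difference of two consecutive three-term expressions, so it says
  that their value does not change.\<close>

lemma recurrence_step:
  fixes s\<^sub>0 s\<^sub>1 s\<^sub>2 s\<^sub>3 \<beta> \<gamma> :: "'a::field"
  assumes "s\<^sub>0 - \<beta> * s\<^sub>1 + s\<^sub>2 = \<gamma>"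
  shows "s\<^sub>1 - \<beta> * s\<^sub>2 + s\<^sub>3 = \<gamma> \<longleftrightarrow> s\<^sub>0 - (\<beta> + 1) * s\<^sub>1 + (\<beta> + 1) * s\<^sub>2 - s\<^sub>3 = 0"
proof -
  have "s\<^sub>0 - (\<beta> + 1) * s\<^sub>1 + (\<beta> + 1) * s\<^sub>2 - s\<^sub>3
      = (s\<^sub>0 - \<beta> * s\<^sub>1 + s\<^sub>2) - (s\<^sub>1 - \<beta> * s\<^sub>2 + s\<^sub>3)"
    by (simp add: algebra_simps)
  then show ?thesis unfolding assms by (metis eq_iff_diff_eq_0)
qed

lemma beta_recurrent_seq_const:
  assumes "\<And>i. i + 2 \<le> n \<Longrightarrow> \<sigma> i - \<beta> * \<sigma> (i + 1) + \<sigma> (i + 2) = \<gamma>"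
  shows "beta_recurrent_seq \<beta> n \<sigma>"
  unfolding beta_recurrent_seq_iff
proof (intro allI impI)
  fix i assume "i + 3 \<le> n"
  then show "\<sigma> i - (\<beta> + 1) * \<sigma> (i + 1) + (\<beta> + 1) * \<sigma> (i + 2) - \<sigma> (i + 3) = 0"
    using assms[of i] assms[of "Suc i"] recurrence_step[of "\<sigma> i" \<beta> "\<sigma> (i + 1)" "\<sigma> (i + 2)" \<gamma> "\<sigma> (i + 3)"]
    by (simp add: eval_nat_numeral)
qed

text \<open>\<open>\<gamma>\<close> is the constant three-term value, and \<open>\<rho>\<close> is
  fitted to the first pair. \<open>td_poly_diff\<close> carries the vanishing from each pair to the
  next.\<close>

lemma beta_recurrent_seq_td_poly:
  assumes "beta_recurrent_seq \<beta> n \<sigma>"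
  obtains \<gamma> \<rho> where "\<And>i. i < n \<Longrightarrow> td_poly \<beta> \<gamma> \<rho> (\<sigma> (Suc i)) (\<sigma> i) = 0"
proof -
  define \<gamma> where "\<gamma> = \<sigma> 0 - \<beta> * \<sigma> 1 + \<sigma> 2"
  define \<rho> where "\<rho> = td_poly \<beta> \<gamma> 0 (\<sigma> 1) (\<sigma> 0)"
  have 1: "\<sigma> i - \<beta> * \<sigma> (i + 1) + \<sigma> (i + 2) = \<gamma>" if "i + 2 \<le> n" for i
    using that
  proof (induction i)
    case (Suc i)
    have "\<sigma> i - (\<beta> + 1) * \<sigma> (i + 1) + (\<beta> + 1) * \<sigma> (i + 2) - \<sigma> (i + 3) = 0"
      using assms[unfolded beta_recurrent_seq_iff] Suc.prems by simp
    then show ?case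
      using Suc recurrence_step[of "\<sigma> i" \<beta> "\<sigma> (i + 1)" "\<sigma> (i + 2)" \<gamma> "\<sigma> (i + 3)"]
      by (simp add: eval_nat_numeral)
  qed (simp add: \<gamma>_def eval_nat_numeral)
  have "td_poly \<beta> \<gamma> \<rho> (\<sigma> (Suc i)) (\<sigma> i) = 0" if "i < n" for i
    using that
  proof (induction i)
    case (Suc i)
    then show ?case
      using 1[of i] td_poly_diff[of \<beta> \<gamma> \<rho> "\<sigma> (Suc i)" "\<sigma> i" "\<sigma> (Suc (Suc i))"] by simp
  qed (simp add: \<rho>_def td_poly_def)
  then show thesis by (rule that)
qed

section \<open>The commutator and its blocks between eigenspaces\<close>

context vector_space
begin

definition td_comm :: "'a \<Rightarrow> 'a \<Rightarrow> 'a \<Rightarrow> ('b \<Rightarrow> 'b) \<Rightarrow> ('b \<Rightarrow> 'b) \<Rightarrow> 'b \<Rightarrow> 'b" where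
  "td_comm \<beta> \<gamma> \<rho> B C = commutator B
    (\<lambda>v. B (B (C v)) - \<beta> *s B (C (B v)) + C (B (B v)) - \<gamma> *s (B (C v) + C (B v)) - \<rho> *s C v)"

lemma endo_td_comm: "endo B \<Longrightarrow> endo C \<Longrightarrow> endo (td_comm \<beta> \<gamma> \<rho> B C)"
  by (rule endoI) (simp_all add: td_comm_def commutator_def endo_simps algebra_simps)

end

text \<open>Half of a CH system: one map with its idempotents, and the other map alone. It is
  instantiated twice, so each fact also holds with the pairs interchanged.\<close>

locale hessenberg = spectral +
  fixes C :: "'b \<Rightarrow> 'b"
  assumes endo_other: "endo C" and three_le: "3 \<le> d" and hessenberg: "circular_Hessenberg d E C"
begin

lemma hessenberg_zero:
  assumes "i \<le> d" "j \<le> d" "Suc j < i \<or> (Suc i < j \<and> j < i + d)"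
  shows "E i (C (E j x)) = 0"
proof -
  have "E i \<circ> C \<circ> E j = (\<lambda>v. 0)"
    using hessenberg[unfolded circular_Hessenberg_def, rule_format, of i j] assms by auto
  then show ?thesis by (metis comp_apply)
qed

text \<open>As \<open>E j\<close> has rank one, a block that is nonzero as a map is nonzero at every
  vector with nonzero \<open>E j\<close> component.\<close>

lemma hessenberg_nonzero:
  assumes "i \<le> d" "j \<le> d" "i = Suc j \<or> (i = 0 \<and> j = d)" "E j x \<noteq> 0"
  shows "E i (C (E j x)) \<noteq> 0"
proof
  assume 0: "E i (C (E j x)) = 0"
  have "E i \<circ> C \<circ> E j \<noteq> (\<lambda>v. 0)"
    using hessenberg[unfolded circular_Hessenberg_def, rule_format, of i j] assms by auto
  then obtain y where y: "E i (C (E j y)) \<noteq> 0" by (auto simp: fun_eq_iff)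
  obtain c where "E j y = c *s E j x" using rank_le assms by blast
  then show False
    using y 0 assms by (simp add: endo_simps endo_other endo_idem)
qed

lemma idem_other_expand:
  assumes "i \<le> d" shows "E i (C x) = (\<Sum>k=0..d. E i (C (E k x)))"
proof -
  have "E i (C x) = E i (C (\<Sum>k=0..d. E k x))" by (simp add: resolution)
  also have "\<dots> = (\<Sum>k=0..d. E i (C (E k x)))"
    using assms by (simp add: endo_sum endo_other endo_idem)
  finally show ?thesis .
qed

text \<open>\<open>C\<close> raises the index by at most one. The exceptional corner block ends at
  index \<open>0\<close>, so it does not disturb this upper bound.\<close>

lemma idem_other_above:
  assumes "\<And>k. m < k \<Longrightarrow> k \<le> d \<Longrightarrow> E k x = 0" "Suc m < i" "i \<le> d"
  shows "E i (C x) = 0"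
proof (subst idem_other_expand[OF assms(3)], rule sum.neutral, rule ballI)
  fix k assume "k \<in> {0..d}"
  then show "E i (C (E k x)) = 0"
    using assms hessenberg_zero[of i k x]
    by (cases "k \<le> m") (auto simp: endo_zero endo_other endo_idem)
qed

text \<open>Components of \<open>x\<close> below the top one cannot reach index
  \<open>Suc m\<close>.\<close>

lemma idem_other_step:
  assumes "\<And>k. m < k \<Longrightarrow> k \<le> d \<Longrightarrow> E k x = 0" "m < d"
  shows "E (Suc m) (C x) = E (Suc m) (C (E m x))"
proof -
  have "E (Suc m) (C x) = (\<Sum>k=0..d. E (Suc m) (C (E k x)))"
    using assms by (intro idem_other_expand) simp
  also have "\<dots> = (\<Sum>k=0..d. if k = m then E (Suc m) (C (E m x)) else 0)"
  proof (rule sum.cong)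
    fix k assume "k \<in> {0..d}"
    then show "E (Suc m) (C (E k x)) = (if k = m then E (Suc m) (C (E m x)) else 0)"
      using assms hessenberg_zero[of "Suc m" k x]
      by (cases "k < m") (auto simp: endo_zero endo_other endo_idem)
  qed simp
  finally show ?thesis using assms by simp
qed

text \<open>A factor \<open>B\<close> becomes \<open>\<theta> i\<close> to the left of
  \<open>C\<close> and \<open>\<theta> j\<close> to its right, so every word collapses to a multiple
  of one block.\<close>

lemma idem_td_comm_idem:
  assumes "i \<le> d" "j \<le> d"
  shows "E i (td_comm \<beta> \<gamma> \<rho> B C (E j x)) =
    ((\<theta> i - \<theta> j) * td_poly \<beta> \<gamma> \<rho> (\<theta> i) (\<theta> j)) *s E i (C (E j x))"
  using assms
  by (simp add: td_comm_def commutator_def td_poly_def endo_simps endo_map endo_other endo_idem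
      idem_map map_idem algebra_simps)

text \<open>The block just below the diagonal is nonzero and the two eigenvalues differ, so the
  polynomial is the factor that must vanish.\<close>

lemma td_poly_zero:
  assumes "td_comm \<beta> \<gamma> \<rho> B C = (\<lambda>v. 0)" "i < d"
  shows "td_poly \<beta> \<gamma> \<rho> (\<theta> (Suc i)) (\<theta> i) = 0"
proof -
  obtain x where "E i x \<noteq> 0" using idem_nonzero[of i] assms by auto
  then have "E (Suc i) (C (E i x)) \<noteq> 0"
    using assms by (intro hessenberg_nonzero) auto
  moreover have "\<theta> (Suc i) \<noteq> \<theta> i"
    using distinct[of "Suc i" i] assms by auto
  ultimately show ?thesis
    using idem_td_comm_idem[of "Suc i" i \<beta> \<gamma> \<rho> x] assms by (simp add: endo_zero endo_idem)
qed

text \<open>Subtracting the polynomial's zeros at two neighbouring pairs leaves the relation times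
  the nonzero \<open>\<theta> i - \<theta> (i + 2)\<close>.\<close>

lemma td_comm_zero_const:
  assumes "td_comm \<beta> \<gamma> \<rho> B C = (\<lambda>v. 0)" "i + 2 \<le> d"
  shows "\<theta> i - \<beta> * \<theta> (i + 1) + \<theta> (i + 2) = \<gamma>"
proof -
  have "\<theta> i \<noteq> \<theta> (i + 2)"
    using distinct[of i "i + 2"] assms by auto
  moreover have "(\<theta> i - \<theta> (i + 2)) * (\<theta> i - \<beta> * \<theta> (i + 1) + \<theta> (i + 2) - \<gamma>) = 0"
    using td_poly_zero[OF assms(1), of i] td_poly_zero[OF assms(1), of "Suc i"] assms(2)
    unfolding td_poly_diff[of \<beta> \<gamma> \<rho>, symmetric] by (simp add: eval_nat_numeral)
  ultimately show ?thesis by simp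
qed

text \<open>On the diagonal the eigenvalue difference vanishes, next to it the polynomial, and
  elsewhere the block of \<open>C\<close>. Only the corner escapes all three.\<close>

lemma idem_td_comm_idem_zero:
  assumes poly: "\<And>i. i < d \<Longrightarrow> td_poly \<beta> \<gamma> \<rho> (\<theta> (Suc i)) (\<theta> i) = 0"
    and "i \<le> d" "j \<le> d" "i \<noteq> 0 \<or> j \<noteq> d"
  shows "E i (td_comm \<beta> \<gamma> \<rho> B C (E j x)) = 0"
proof -
  consider "i = j" | "i = Suc j" | "j = Suc i" | "Suc j < i \<or> (Suc i < j \<and> j < i + d)"
    using assms by linarith
  then show ?thesis
  proof cases
    case 3
    then show ?thesis
      using assms poly[of i] by (simp add: idem_td_comm_idem td_poly_commute)
  next
    case 4
    then show ?thesis
      using assms hessenberg_zero by (simp add: idem_td_comm_idem)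
  qed (use assms in \<open>simp_all add: idem_td_comm_idem\<close>)
qed

lemma td_comm_idem_zero:
  assumes poly: "\<And>i. i < d \<Longrightarrow> td_poly \<beta> \<gamma> \<rho> (\<theta> (Suc i)) (\<theta> i) = 0" and "j < d"
  shows "td_comm \<beta> \<gamma> \<rho> B C (E j x) = 0"
  by (rule eqI_idem) (use assms in \<open>simp add: idem_td_comm_idem_zero endo_zero endo_idem\<close>)

text \<open>The commutator factors through the rank-one map \<open>E d\<close>, so a single test
  vector with nonzero \<open>E d\<close> component decides it.\<close>

lemma td_comm_zeroI:
  assumes poly: "\<And>i. i < d \<Longrightarrow> td_poly \<beta> \<gamma> \<rho> (\<theta> (Suc i)) (\<theta> i) = 0"
    and y: "E d y \<noteq> 0" "td_comm \<beta> \<gamma> \<rho> B C y = 0"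
  shows "td_comm \<beta> \<gamma> \<rho> B C = (\<lambda>v. 0)"
proof
  let ?D = "td_comm \<beta> \<gamma> \<rho> B C"
  have endo: "endo ?D" by (rule endo_td_comm[OF endo_map endo_other])
  have top: "?D x = ?D (E d x)" for x
  proof -
    have "?D x = ?D (\<Sum>j=0..d. E j x)" by (simp add: resolution)
    also have "\<dots> = (\<Sum>j=0..d. if j = d then ?D (E d x) else 0)"
      unfolding endo_sum[OF endo] by (intro sum.cong) (auto simp: td_comm_idem_zero[OF poly])
    finally show ?thesis by simp
  qed
  fix x
  obtain c where "E d x = c *s E d y" using rank_le[OF _ y(1)] by auto
  then have "?D x = c *s ?D y"
    using top[of x] top[of y] by (simp add: endo_scale[OF endo])
  then show "?D x = 0" by (simp add: y)
qed

lemma td_comm_in_first: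
  assumes poly: "\<And>i. i < d \<Longrightarrow> td_poly \<beta> \<gamma> \<rho> (\<theta> (Suc i)) (\<theta> i) = 0"
  shows "td_comm \<beta> \<gamma> \<rho> B C x = E 0 (td_comm \<beta> \<gamma> \<rho> B C x)"
proof (rule eq_idemI)
  let ?D = "td_comm \<beta> \<gamma> \<rho> B C"
  fix i assume i: "i \<le> d" "i \<noteq> 0"
  have "E i (?D x) = E i (?D (\<Sum>j=0..d. E j x))" by (simp add: resolution)
  also have "\<dots> = (\<Sum>j=0..d. E i (?D (E j x)))"
    using i by (simp add: endo_sum endo_td_comm endo_map endo_other endo_idem)
  also have "\<dots> = 0"
    using i by (intro sum.neutral) (auto simp: idem_td_comm_idem_zero[OF poly])
  finally show "E i (?D x) = 0" .
qed simp

end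

section \<open>The split basis and the split sequence\<close>

context vector_space
begin

lemma represents_lower_bidiagonal:
  "represents d v (\<lambda>i j. if i = j then a j else if i = j + 1 then 1 else 0) B \<longleftrightarrow>
    (\<forall>j\<le>d. B (v j) = a j *s v j + (if j < d then v (Suc j) else 0))"
proof -
  have "(\<Sum>i=0..d. (if i = j then a j else if i = j + 1 then 1 else 0) *s v i) =
      a j *s v j + (if j < d then v (Suc j) else 0)" if "j \<le> d" for j
  proof -
    have "(\<Sum>i=0..d. (if i = j then a j else if i = j + 1 then 1 else 0) *s v i) =
      (\<Sum>i=0..d. (if i = j then a j *s v j else 0) + (if i = Suc j then v (Suc j) else 0))"
      by (intro sum.cong) auto
    then show ?thesis using that by (auto simp: sum.distrib)
  qed
  then show ?thesis by (auto simp: represents_def)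
qed

lemma represents_upper_bidiagonal:
  "represents d v (\<lambda>i j. if i = j then b j else if j = i + 1 then \<phi> j else 0) B \<longleftrightarrow>
    (\<forall>j\<le>d. B (v j) = b j *s v j + (if 0 < j then \<phi> j *s v (j - 1) else 0))"
proof -
  have "(\<Sum>i=0..d. (if i = j then b j else if j = i + 1 then \<phi> j else 0) *s v i) =
      b j *s v j + (if 0 < j then \<phi> j *s v (j - 1) else 0)" if "j \<le> d" for j
  proof -
    have "(\<Sum>i=0..d. (if i = j then b j else if j = i + 1 then \<phi> j else 0) *s v i) =
      (\<Sum>i=0..d. (if i = j then b j *s v j else 0) +
        (if i = j - 1 then (if 0 < j then \<phi> j *s v (j - 1) else 0) else 0))"
      by (intro sum.cong) auto
    then show ?thesis using that by (auto simp: sum.distrib)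
  qed
  then show ?thesis by (auto simp: represents_def)
qed

lemma is_split_seq_iff:
  "is_split_seq d A E As Es \<phi> \<longleftrightarrow>
    (\<forall>i\<in>{1..d}. \<phi> i \<noteq> 0) \<and>
    (\<exists>v. is_basis d v \<and>
      (\<forall>j\<le>d. A (v j) = eigenvalue_seq A E (d - j) *s v j + (if j < d then v (Suc j) else 0)) \<and>
      (\<forall>j\<le>d. As (v j) = eigenvalue_seq As Es j *s v j + (if 0 < j then \<phi> j *s v (j - 1) else 0)))"
proof -
  have *: "(\<lambda>i j. if i = j then eigenvalue_seq A E (d - i) else if i = j + 1 then 1 else 0) =
      (\<lambda>i j. if i = j then eigenvalue_seq A E (d - j) else if i = j + 1 then 1 else 0)"
    "(\<lambda>i j. if i = j then eigenvalue_seq As Es i else if j = i + 1 then \<phi> j else 0) =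
      (\<lambda>i j. if i = j then eigenvalue_seq As Es j else if j = i + 1 then \<phi> j else 0)"
    by (auto simp: fun_eq_iff)
  show ?thesis
    unfolding is_split_seq_def * represents_lower_bidiagonal represents_upper_bidiagonal ..
qed

end

text \<open>\<open>u\<close> spans the first dual eigenspace. Existence and uniqueness of the split
  sequence are derived from it, so that the description in \<open>split_seq\<close> can be
  evaluated.\<close>

locale split_basis = vector_space scale +
    A: hessenberg scale d A E \<theta> As + As: hessenberg scale d As Es \<theta>s A
  for scale :: "'a::field \<Rightarrow> 'b::ab_group_add \<Rightarrow> 'b" (infixr "*s" 75)
    and d A E \<theta> As Es \<theta>s +
  fixes u :: 'b
  assumes dim: "dim UNIV = Suc d" and u: "Es 0 u = u" "u \<noteq> 0"
begin

text \<open>The lower bidiagonal shape of \<open>A\<close> forces this recursion. It can run past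
  \<open>d\<close> because the vectors vanish there.\<close>

primrec vec :: "nat \<Rightarrow> 'b" where
  "vec 0 = u"
| "vec (Suc i) = A (vec i) - \<theta> (d - i) *s vec i"

lemma A_vec: "A (vec i) = \<theta> (d - i) *s vec i + vec (Suc i)"
  by simp

lemma dual_idem_vec_zero: "i < j \<Longrightarrow> j \<le> d \<Longrightarrow> Es j (vec i) = 0"
proof (induction i arbitrary: j)
  case 0
  then show ?case
    using As.idem_idem[of j 0 u] u by simp
next
  case (Suc i)
  then show ?case
    using As.idem_other_above[of i "vec i" j] by (simp add: endo_simps As.endo_idem)
qed

text \<open>The leading dual component is passed upwards through the nonzero subdiagonal blocks of
  \<open>A\<close>.\<close>

lemma dual_idem_vec_nonzero: "i \<le> d \<Longrightarrow> Es i (vec i) \<noteq> 0"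
proof (induction i)
  case (Suc i)
  have "Es (Suc i) (vec (Suc i)) = Es (Suc i) (A (Es i (vec i)))"
    using Suc.prems As.idem_other_step[of i "vec i"]
    by (simp add: endo_simps As.endo_idem dual_idem_vec_zero)
  then show ?case
    using Suc As.hessenberg_nonzero[of "Suc i" i "vec i"] by simp
qed (simp add: u)

text \<open>\<open>vec i\<close> is a polynomial in \<open>A\<close> applied to \<open>u\<close>,
  and \<open>E j\<close> evaluates that polynomial at \<open>\<theta> j\<close>.\<close>

lemma idem_vec: "j \<le> d \<Longrightarrow> E j (vec i) = (\<Prod>l<i. \<theta> j - \<theta> (d - l)) *s E j u"
  by (induction i) (simp_all add: endo_simps A.endo_idem A.idem_map algebra_simps)

lemma idem_vec_zero: "j \<le> d \<Longrightarrow> d < i + j \<Longrightarrow> E j (vec i) = 0"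
proof -
  assume j: "j \<le> d" "d < i + j"
  \<comment> \<open>The factor with \<open>l = d - j\<close> is the one that vanishes.\<close>
  then have "d - j \<in> {..<i}" "\<theta> j - \<theta> (d - (d - j)) = 0" by auto
  then have "(\<Prod>l<i. \<theta> j - \<theta> (d - l)) = 0"
    by (meson finite_lessThan prod_zero)
  then show ?thesis using j by (simp add: idem_vec)
qed

lemma vec_zero: "d < i \<Longrightarrow> vec i = 0"
  by (rule A.eqI_idem) (simp add: idem_vec_zero endo_zero A.endo_idem del: vec.simps)

text \<open>Elimination from the top: subtracting a multiple of \<open>vec m\<close> removes the
  dual component \<open>m\<close> and creates none above it.\<close>

lemma in_span_vec:
  assumes "m \<le> Suc d" "\<And>j. m \<le> j \<Longrightarrow> j \<le> d \<Longrightarrow> Es j x = 0"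
  shows "x \<in> span (vec ` {..<m})"
  using assms
proof (induction m arbitrary: x)
  case 0
  then have "x = 0"
    by (intro As.eqI_idem[of x 0]) (simp add: endo_zero As.endo_idem)
  then show ?case by (simp add: span_zero)
next
  case (Suc m)
  then obtain c where c: "Es m x = c *s Es m (vec m)"
    using As.rank_le dual_idem_vec_nonzero by (metis Suc_le_mono)
  have "x - c *s vec m \<in> span (vec ` {..<m})"
  proof (rule Suc.IH)
    fix j assume "m \<le> j" "j \<le> d"
    then show "Es j (x - c *s vec m) = 0"
      using c Suc.prems dual_idem_vec_zero[of m j]
      by (cases "j = m") (simp_all add: endo_simps As.endo_idem)
  qed (use Suc in simp)
  then have "x - c *s vec m \<in> span (vec ` {..<Suc m})"
    by (rule subsetD[OF span_mono, rotated]) auto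
  moreover have "c *s vec m \<in> span (vec ` {..<Suc m})"
    by (intro span_scale span_base) auto
  ultimately have "(x - c *s vec m) + c *s vec m \<in> span (vec ` {..<Suc m})"
    by (rule span_add)
  then show ?case by simp
qed

lemma basis: "is_basis d vec"
proof (rule is_basis_if_spanning[OF dim])
  have "{..<Suc d} = {0..d}" by auto
  then show "span (vec ` {0..d}) = UNIV"
    using in_span_vec[of "Suc d"] by auto
qed

lemma idem_u_nonzero: assumes "j \<le> d" shows "E j u \<noteq> 0"
proof
  assume "E j u = 0"
  then have "E j = (\<lambda>x. 0)"
    using basis assms
    by (intro endo_eqI[of _ _ "vec ` {0..d}"])
      (auto simp: is_basis_def A.endo_idem idem_vec intro!: endoI simp del: vec.simps)
  then show False
    using A.idem_nonzero[OF assms] by (auto simp: fun_eq_iff)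
qed

lemma idem_vec_nonzero: assumes "i + j \<le> d" shows "E j (vec i) \<noteq> 0"
proof -
  have "\<theta> j - \<theta> (d - l) \<noteq> 0" if "l < i" for l
    using A.distinct[of j "d - l"] assms that by auto
  then show ?thesis
    using assms idem_u_nonzero[of j] by (simp add: idem_vec prod_zero_iff)
qed

text \<open>
  \<open>E (d - k)\<close> kills every vector \<open>vec l\<close> with \<open>l > k\<close> but not \<open>vec k\<close>, so it reads off the
  coefficient of \<open>vec k\<close>.
\<close>

lemma span_vec_zero:
  assumes "k \<le> m" "m \<le> Suc d" "y \<in> span (vec ` {k..<m})"
    and "\<And>j. j \<le> d \<Longrightarrow> d < m + j \<Longrightarrow> E j y = 0"
  shows "y = 0"
  using assms(1,3)
proof (induction rule: inc_induct)
  case (step k)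
  have "{k..<m} = insert k {Suc k..<m}" using step by auto
  then obtain a where a: "y - a *s vec k \<in> span (vec ` {Suc k..<m})"
    using step.prems by (auto simp: span_insert)
  have "E (d - k) z = 0" if "z \<in> span (vec ` {Suc k..<m})" for z
    using that
  proof (induction rule: span_induct_alt)
    case (step c x y)
    then show ?case
      using assms(2) by (auto simp: endo_simps A.endo_idem idem_vec_zero simp del: vec.simps)
  qed (simp add: endo_zero A.endo_idem)
  from this[OF a] have "E (d - k) y = a *s E (d - k) (vec k)"
    by (simp add: endo_simps A.endo_idem)
  moreover have "E (d - k) y = 0"
    using step assms by (intro assms(4)) auto
  moreover have "E (d - k) (vec k) \<noteq> 0"
    using step assms by (intro idem_vec_nonzero) auto
  ultimately have "a = 0" by simp
  then show ?case using a step.IH by simp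
qed simp

text \<open>The dual eigenspaces up to \<open>m\<close> and the eigenspaces up to
  \<open>d - m\<close> belong to opposite flags, which meet in the line of \<open>vec m\<close>.
  Elimination leaves a combination of earlier vectors, which \<open>span_vec_zero\<close>
  kills.\<close>

lemma split_line:
  assumes "m \<le> d" "\<And>j. m < j \<Longrightarrow> j \<le> d \<Longrightarrow> Es j x = 0"
    and "\<And>j. j \<le> d \<Longrightarrow> d < m + j \<Longrightarrow> E j x = 0"
  shows "\<exists>c. x = c *s vec m"
proof -
  obtain c where c: "Es m x = c *s Es m (vec m)"
    using As.rank_le dual_idem_vec_nonzero assms by metis
  have "x - c *s vec m \<in> span (vec ` {..<m})"
  proof (rule in_span_vec)
    fix j assume "m \<le> j" "j \<le> d"
    then show "Es j (x - c *s vec m) = 0"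
      using c assms dual_idem_vec_zero[of m j]
      by (cases "j = m") (simp_all add: endo_simps As.endo_idem)
  qed (use assms in simp)
  then have "x - c *s vec m = 0"
    by (intro span_vec_zero[of 0 m "x - c *s vec m"])
      (use assms in \<open>simp_all add: endo_simps A.endo_idem idem_vec_zero lessThan_atLeast0\<close>)
  then show ?thesis by auto
qed

lemma As_vec_0: "As (vec 0) = \<theta>s 0 *s vec 0"
  using As.map_idem[of 0 u] u by simp

text \<open>Subtracting the diagonal term removes the top dual component, while \<open>As\<close>
  raises the other index by at most one; the rest lies in both flags at level
  \<open>i\<close>.\<close>

lemma As_vec_Suc:
  assumes "i < d"
  shows "\<exists>c. c \<noteq> 0 \<and> As (vec (Suc i)) = \<theta>s (Suc i) *s vec (Suc i) + c *s vec i"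
proof -
  let ?x = "As (vec (Suc i)) - \<theta>s (Suc i) *s vec (Suc i)"
  have "\<exists>c. ?x = c *s vec i"
  proof (rule split_line)
    fix j assume "i < j" "j \<le> d"
    then show "Es j ?x = 0"
      using dual_idem_vec_zero[of "Suc i" j]
      by (cases "j = Suc i") (simp_all add: endo_simps As.endo_idem As.idem_map del: vec.simps)
  next
    fix j assume j: "j \<le> d" "d < i + j"
    have "E j (As (vec (Suc i))) = 0"
      using j assms by (intro A.idem_other_above[of "d - Suc i"] idem_vec_zero) auto
    then show "E j ?x = 0"
      using j idem_vec_zero[of j "Suc i"] by (simp add: endo_simps A.endo_idem del: vec.simps)
  qed (use assms in simp)
  then obtain c where c: "?x = c *s vec i" ..
  have "c \<noteq> 0"
  proof
    assume "c = 0"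
    then have As0: "As (vec (Suc i)) = \<theta>s (Suc i) *s vec (Suc i)" using c by simp
    \<comment> \<open>\<open>m\<close> is the top index of \<open>vec (Suc i)\<close> with respect
      to \<open>E\<close>. \<open>As\<close> creates a nonzero component at \<open>Suc m\<close>, so
      this vector is no eigenvector.\<close>
    define m where "m = d - Suc i"
    have m: "m < d" "Suc m \<le> d" "Suc i + m = d" using assms by (auto simp: m_def)
    have "E (Suc m) (As (vec (Suc i))) = E (Suc m) (As (E m (vec (Suc i))))"
      using m by (intro A.idem_other_step idem_vec_zero) auto
    moreover have "\<dots> \<noteq> 0"
      using m by (intro A.hessenberg_nonzero idem_vec_nonzero) auto
    moreover have "E (Suc m) (vec (Suc i)) = 0"
      using m by (intro idem_vec_zero) auto
    ultimately show False
      using As0 m by (simp add: endo_simps A.endo_idem del: vec.simps)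
  qed
  moreover have "As (vec (Suc i)) = \<theta>s (Suc i) *s vec (Suc i) + c *s vec i"
    using c by (metis add.commute diff_add_cancel)
  ultimately show ?thesis by blast
qed

lemma ex_split_coeffs:
  obtains \<phi> where "\<And>i. i \<in> {1..d} \<Longrightarrow> \<phi> i \<noteq> 0" "\<And>i. i \<notin> {1..d} \<Longrightarrow> \<phi> i = 0"
    "\<And>i. As (vec i) = \<theta>s i *s vec i + \<phi> i *s vec (i - 1)"
proof -
  obtain c where c: "\<And>i. i < d \<Longrightarrow> c i \<noteq> 0"
    "\<And>i. i < d \<Longrightarrow> As (vec (Suc i)) = \<theta>s (Suc i) *s vec (Suc i) + c i *s vec i"
    using As_vec_Suc by metis
  show thesis
  \<comment> \<open>Extension by \<open>0\<close> makes the relation hold at every index: at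
    \<open>0\<close> it hides the truncated \<open>i - 1\<close>, and at \<open>d + 1\<close> it
    cancels \<open>vec d\<close>.\<close>
  proof (rule that[of "\<lambda>i. if i \<in> {1..d} then c (i - 1) else 0"])
    fix i
    show "As (vec i) = \<theta>s i *s vec i + (if i \<in> {1..d} then c (i - 1) else 0) *s vec (i - 1)"
    proof (cases "i \<in> {1..d}")
      case True
      moreover from this have "i - 1 < d" "Suc (i - 1) = i" by auto
      ultimately show ?thesis using c(2)[of "i - 1"] by (simp del: vec.simps)
    next
      case False
      then consider "i = 0" | "d < i" by force
      then show ?thesis
        by cases (use As_vec_0 in \<open>simp_all add: vec_zero endo_zero A.endo_other del: vec.simps\<close>)
    qed
  qed (use c(1) in auto)
qed

text \<open>The first vector of any such basis is an eigenvector of \<open>As\<close> for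
  \<open>\<theta>s 0\<close>, hence a multiple of \<open>u\<close>. The action of \<open>A\<close>
  then makes \<open>v\<close> the same multiple of \<open>vec\<close> throughout.\<close>

lemma split_coeffs_unique:
  assumes \<phi>: "\<And>i. As (vec i) = \<theta>s i *s vec i + \<phi> i *s vec (i - 1)"
    and v: "is_basis d v"
      "\<forall>j\<le>d. A (v j) = \<theta> (d - j) *s v j + (if j < d then v (Suc j) else 0)"
      "\<forall>j\<le>d. As (v j) = \<theta>s j *s v j + (if 0 < j then \<psi> j *s v (j - 1) else 0)"
    and i: "i \<in> {1..d}"
  shows "\<psi> i = \<phi> i"
proof -
  have "v 0 = Es 0 (v 0)"
  proof (rule As.eq_idemI)
    fix j assume j: "j \<le> d" "j \<noteq> 0"
    have "Es j (As (v 0)) = \<theta>s 0 *s Es j (v 0)"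
      using v(3) j by (simp add: endo_simps As.endo_idem)
    then have "\<theta>s j = \<theta>s 0 \<or> Es j (v 0) = 0"
      using j by (simp add: As.idem_map)
    then show "Es j (v 0) = 0"
      using As.distinct[of j 0] j by auto
  qed simp
  moreover obtain c where "Es 0 (v 0) = c *s Es 0 u"
    using As.rank_le[of 0 u] u by auto
  ultimately have c: "v 0 = c *s u" using u by simp
  have vec: "v j = c *s vec j" if "j \<le> d" for j
    using that
  proof (induction j)
    case (Suc j)
    have "v (Suc j) = A (v j) - \<theta> (d - j) *s v j"
      using v(2)[rule_format, of j] Suc.prems by simp
    then show ?case
      using Suc by (simp add: endo_simps A.endo_map algebra_simps)
  qed (simp add: c)
  have "\<theta>s i *s v i + \<psi> i *s v (i - 1) = As (v i)"
    using v(3) i by simp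
  also have "\<dots> = c *s As (vec i)"
    using vec i by (simp add: endo_simps A.endo_other)
  also have "\<dots> = \<theta>s i *s v i + \<phi> i *s v (i - 1)"
    using vec[of i] vec[of "i - 1"] i by (auto simp: \<phi> scale_right_distrib mult.commute)
  finally have "\<psi> i *s v (i - 1) = \<phi> i *s v (i - 1)" by simp
  moreover have "v (i - 1) \<noteq> 0"
  proof
    assume "v (i - 1) = 0"
    moreover have "v (i - 1) \<in> v ` {0..d}" using i by (intro imageI) auto
    ultimately show False
      using v(1) dependent_zero[of "v ` {0..d}"] by (simp add: is_basis_def)
  qed
  ultimately show ?thesis by simp
qed

end

text \<open>
  The alternatives \<open>b\<^sub>0 = 0\<close> and \<open>a\<^sub>2 = 0\<close> serve the two ends of the recurrence for \<open>\<vartheta>\<close>,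
  where one of the neighbouring eigenvalues does not exist.
\<close>

lemma vartheta_identity:
  fixes \<beta> :: "'a::field"
  assumes "b\<^sub>0 = 0 \<or> a - (\<beta> + 1) * a\<^sub>0 + (\<beta> + 1) * a\<^sub>1 - a\<^sub>2 = 0"
    and "a\<^sub>2 = 0 \<or> b\<^sub>0 - (\<beta> + 1) * b\<^sub>1 + (\<beta> + 1) * b\<^sub>2 - b\<^sub>3 = 0"
  shows "b\<^sub>0 * a - (\<beta> + 1) * (b\<^sub>1 * a\<^sub>0) + (\<beta> + 1) * (b\<^sub>2 * a\<^sub>1) - b\<^sub>3 * a\<^sub>2 =
    - ((\<beta> + 1) * (b\<^sub>0 * (a\<^sub>1 - a\<^sub>0) + b\<^sub>1 * (a\<^sub>0 - a\<^sub>2) + b\<^sub>2 * (a\<^sub>2 - a\<^sub>1)))"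
proof -
  have a: "b\<^sub>0 * a = b\<^sub>0 * ((\<beta> + 1) * a\<^sub>0 - (\<beta> + 1) * a\<^sub>1 + a\<^sub>2)"
  proof (cases "b\<^sub>0 = 0")
    case False
    then have "a - ((\<beta> + 1) * a\<^sub>0 - (\<beta> + 1) * a\<^sub>1 + a\<^sub>2) = 0"
      using assms(1) by (simp add: algebra_simps)
    then show ?thesis by simp
  qed simp
  have b: "b\<^sub>3 * a\<^sub>2 = (b\<^sub>0 - (\<beta> + 1) * b\<^sub>1 + (\<beta> + 1) * b\<^sub>2) * a\<^sub>2"
    using assms(2) by auto
  show ?thesis unfolding a b by (simp add: algebra_simps)
qed

section \<open>Commutator coefficients in the split basis\<close>

locale split_coeffs = split_basis +
  fixes \<phi> :: "nat \<Rightarrow> 'a"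
  assumes As_vec: "As (vec i) = \<theta>s i *s vec i + \<phi> i *s vec (i - 1)"
    and \<phi>_outside: "i \<notin> {1..d} \<Longrightarrow> \<phi> i = 0"
begin

abbreviation crd :: "nat \<Rightarrow> 'b \<Rightarrow> 'a" where
  "crd k \<equiv> coord d vec k"

lemma crd_vec: "k \<le> d \<Longrightarrow> crd k (vec j) = (if k = j then 1 else 0)"
  by (cases "j \<le> d") (auto simp: coord_basis[OF basis] vec_zero coord_zero simp del: vec.simps)

lemmas crd_simps = coord_add[OF basis] coord_diff[OF basis] coord_scale[OF basis] coord_zero crd_vec

lemmas word_simps = td_comm_def commutator_def endo_simps A.endo_map As.endo_map A_vec As_vec

text \<open>A word with three factors \<open>A\<close> either rises three times and drops once
  through \<open>As\<close>, giving the \<open>\<phi>\<close> terms, or rises twice and picks up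
  diagonal entries. The \<open>\<rho>\<close> words rise too little.\<close>

lemma crd_td_comm_up2:
  assumes "i + 2 \<le> d"
  shows "crd (i + 2) (td_comm \<beta> \<gamma> \<rho> A As (vec i)) =
    \<phi> i - (\<beta> + 1) * \<phi> (i + 1) + (\<beta> + 1) * \<phi> (i + 2) - \<phi> (i + 3)
    + \<theta>s i * (\<theta> (d - i) + \<theta> (d - (i + 1)) + \<theta> (d - (i + 2)))
    - (\<beta> + 1) * (\<theta> (d - i) * \<theta>s i + \<theta>s (i + 1) * (\<theta> (d - (i + 1)) + \<theta> (d - (i + 2))))
    + (\<beta> + 1) * ((\<theta> (d - i) + \<theta> (d - (i + 1))) * \<theta>s (i + 1) + \<theta>s (i + 2) * \<theta> (d - (i + 2)))
    - \<theta>s (i + 2) * (\<theta> (d - i) + \<theta> (d - (i + 1)) + \<theta> (d - (i + 2)))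
    - \<gamma> * (\<theta>s i - \<theta>s (i + 2))"
\<comment> \<open>At \<open>i = 0\<close> the index \<open>i - 1\<close> is truncated, and
  \<open>\<phi> 0 = 0\<close> removes the spurious term.\<close>
proof (cases i)
  case 0
  then show ?thesis
    using assms \<phi>_outside[of 0]
    by (simp add: word_simps crd_simps eval_nat_numeral del: vec.simps) (simp add: algebra_simps)
next
  case (Suc k)
  then show ?thesis
    using assms
    by (simp add: word_simps crd_simps eval_nat_numeral del: vec.simps) (simp add: algebra_simps)
qed

text \<open>A rise by three takes all three factors \<open>A\<close> and leaves \<open>As\<close>
  acting diagonally; it leads from \<open>0\<close> to \<open>d\<close> only for
  \<open>d = 3\<close>.\<close>

lemma crd_td_comm_first:
  "crd d (td_comm \<beta> \<gamma> \<rho> A As (vec 0)) =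
    (if d = 3 then \<theta>s 0 - (\<beta> + 1) * \<theta>s 1 + (\<beta> + 1) * \<theta>s 2 - \<theta>s 3 else 0)"
  using A.three_le \<phi>_outside[of 0]
  by (simp add: word_simps crd_simps eval_nat_numeral del: vec.simps) (simp add: algebra_simps)

text \<open>Dually, three factors \<open>As\<close> lower the index by three and contribute the
  product of the \<open>\<phi>\<close>, while \<open>A\<close> acts diagonally.\<close>

lemma crd_td_comm_last:
  "crd 0 (td_comm \<beta> \<gamma> \<rho> As A (vec d)) =
    (if d = 3 then \<phi> 1 * \<phi> 2 * \<phi> 3 *
      (\<theta> 0 - (\<beta> + 1) * \<theta> 1 + (\<beta> + 1) * \<theta> 2 - \<theta> 3) else 0)"
proof -
  obtain m where d: "d = Suc (Suc (Suc m))"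
    using le_Suc_ex[OF A.three_le] by (auto simp: eval_nat_numeral)
  then have "vec d = vec (Suc (Suc (Suc m)))" "d - Suc (Suc (Suc m)) = 0" "d - Suc (Suc m) = 1"
    "d - Suc m = 2" "d - m = 3" "d = 3 \<longleftrightarrow> m = 0"
    by (auto simp del: vec.simps)
  then show ?thesis
    by (simp add: word_simps crd_simps del: vec.simps) (simp add: eval_nat_numeral algebra_simps)
qed

end

text \<open>Eliminating \<open>\<gamma>\<close> leaves a cyclic sum that is invariant under
  translating all \<open>a\<close> or all \<open>b\<close>, hence comparable with the shifted
  factors in \<open>vartheta\<close>.\<close>

lemma up2_identity:
  fixes \<beta> :: "'a::field"
  assumes "a\<^sub>0 - \<beta> * a\<^sub>1 + a\<^sub>2 = \<gamma>"
  shows "b\<^sub>0 * (a\<^sub>0 + a\<^sub>1 + a\<^sub>2) - (\<beta> + 1) * (a\<^sub>0 * b\<^sub>0 + b\<^sub>1 * (a\<^sub>1 + a\<^sub>2))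
      + (\<beta> + 1) * ((a\<^sub>0 + a\<^sub>1) * b\<^sub>1 + b\<^sub>2 * a\<^sub>2) - b\<^sub>2 * (a\<^sub>0 + a\<^sub>1 + a\<^sub>2) - \<gamma> * (b\<^sub>0 - b\<^sub>2)
    = (\<beta> + 1) * (b\<^sub>0 * (a\<^sub>1 - a\<^sub>0) + b\<^sub>1 * (a\<^sub>0 - a\<^sub>2) + b\<^sub>2 * (a\<^sub>2 - a\<^sub>1))"
  unfolding assms[symmetric] by (simp add: algebra_simps)

section \<open>Recurrence of the three sequences and vanishing of the commutators\<close>

context split_coeffs
begin

definition vartheta :: "nat \<Rightarrow> 'a" where
  "vartheta i = (if 1 \<le> i \<and> i \<le> d then \<phi> i - (\<theta>s i - \<theta>s 0) * (\<theta> (d - i + 1) - \<theta> 0) else 0)"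

text \<open>At \<open>i = 0\<close> and \<open>i = d + 1\<close> the product vanishes because one of its factors does.\<close>

lemma vartheta_eq:
  "i \<le> Suc d \<Longrightarrow> vartheta i = \<phi> i - (\<theta>s i - \<theta>s 0) * (\<theta> (Suc d - i) - \<theta> 0)"
  using \<phi>_outside[of i] by (cases "i = 0 \<or> i = Suc d") (auto simp: vartheta_def Suc_diff_le)

text \<open>The commutator maps \<open>u\<close> into the line of \<open>vec d\<close>, so one
  coefficient decides whether it kills \<open>u\<close>; and \<open>u\<close> has a nonzero
  \<open>E d\<close> component.\<close>

lemma td_comm_A_zero:
  assumes rec: "beta_recurrent_seq \<beta> d \<theta>" "beta_recurrent_seq \<beta> d \<theta>s"
  shows "\<exists>\<gamma> \<rho>. td_comm \<beta> \<gamma> \<rho> A As = (\<lambda>v. 0)"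
proof -
  obtain \<gamma> \<rho> where poly: "\<And>i. i < d \<Longrightarrow> td_poly \<beta> \<gamma> \<rho> (\<theta> (Suc i)) (\<theta> i) = 0"
    using rec(1) by (rule beta_recurrent_seq_td_poly) (rule that)
  let ?D = "td_comm \<beta> \<gamma> \<rho> A As"
  have "vec d = E 0 (vec d)"
    by (rule A.eq_idemI) (auto intro: idem_vec_zero simp del: vec.simps)
  moreover obtain c where "E 0 (?D (vec 0)) = c *s E 0 (vec d)"
    using A.rank_le[OF _ idem_vec_nonzero] by force
  ultimately have c: "?D (vec 0) = c *s vec d"
    using A.td_comm_in_first[OF poly] by metis
  moreover have "crd d (?D (vec 0)) = 0"
    unfolding crd_td_comm_first
    using rec(2)[unfolded beta_recurrent_seq_iff, rule_format, of 0]
    by (simp add: numeral_2_eq_2 del: vec.simps)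
  ultimately have "?D u = 0"
    by (simp add: crd_simps del: vec.simps(2))
  then have "?D = (\<lambda>v. 0)"
    using A.td_comm_zeroI[OF poly idem_u_nonzero] by blast
  then show ?thesis by blast
qed

text \<open>The ends are interchanged: the test vector is \<open>vec d\<close>, and its image lies
  on the line of \<open>vec 0\<close>.\<close>

lemma td_comm_As_zero:
  assumes rec: "beta_recurrent_seq \<beta> d \<theta>" "beta_recurrent_seq \<beta> d \<theta>s"
  shows "\<exists>\<gamma> \<rho>. td_comm \<beta> \<gamma> \<rho> As A = (\<lambda>v. 0)"
proof -
  obtain \<gamma> \<rho> where poly: "\<And>i. i < d \<Longrightarrow> td_poly \<beta> \<gamma> \<rho> (\<theta>s (Suc i)) (\<theta>s i) = 0"
    using rec(2) by (rule beta_recurrent_seq_td_poly) (rule that)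
  let ?D = "td_comm \<beta> \<gamma> \<rho> As A"
  obtain c where "Es 0 (?D (vec d)) = c *s Es 0 u"
    using As.rank_le[of 0 u] u by auto
  then have c: "?D (vec d) = c *s vec 0"
    using As.td_comm_in_first[OF poly, of "vec d"] u by simp
  moreover have "crd 0 (?D (vec d)) = 0"
    unfolding crd_td_comm_last
    using rec(1)[unfolded beta_recurrent_seq_iff, rule_format, of 0]
    by (simp add: numeral_2_eq_2 del: vec.simps)
  ultimately have "?D (vec d) = 0"
    using crd_vec[of 0 0] by (simp add: crd_simps del: vec.simps(2))
  then have "?D = (\<lambda>v. 0)"
    using As.td_comm_zeroI[OF poly dual_idem_vec_nonzero] by blast
  then show ?thesis by blast
qed

text \<open>The coefficient of \<open>vec (i + 2)\<close> gives the recurrence for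
  \<open>\<phi>\<close> up to an error term. The products subtracted in \<open>vartheta\<close> have
  the same error term, so the two cancel.\<close>

lemma beta_recurrent_vartheta:
  assumes A0: "td_comm \<beta> \<gamma> \<rho> A As = (\<lambda>v. 0)" and As0: "td_comm \<beta> \<gamma>s \<rho>s As A = (\<lambda>v. 0)"
  shows "beta_recurrent_seq \<beta> (d + 1) vartheta"
  unfolding beta_recurrent_seq_iff
proof (intro allI impI)
  fix i assume "i + 3 \<le> d + 1"
  then have i: "i + 2 \<le> d" by simp
  \<comment> \<open>The eigenvalues in reverse, offset so that \<open>a k - \<theta> 0\<close> is
    the factor in \<open>vartheta k\<close>. Thus \<open>a (d + 1) = \<theta> 0\<close>, while
    \<open>a 0\<close> refers past the last eigenvalue.\<close>
  define a where "a k = \<theta> (Suc d - k)" for k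
  have d_diff: "\<theta> (d - i) = a (i + 1)" "\<theta> (d - (i + 1)) = a (i + 2)" "\<theta> (d - (i + 2)) = a (i + 3)"
    by (simp_all add: a_def numeral_3_eq_3)
  \<comment> \<open>The three-term relation is symmetric, so it survives the reversal.\<close>
  have \<gamma>: "a (i + 1) - \<beta> * a (i + 2) + a (i + 3) = \<gamma>"
  proof -
    obtain k where "d = i + 2 + k" using i le_Suc_ex by blast
    then have "a (i + 1) = \<theta> (k + 2)" "a (i + 2) = \<theta> (k + 1)" "a (i + 3) = \<theta> k" "k + 2 \<le> d"
      by (simp_all add: a_def)
    then show ?thesis
      using A.td_comm_zero_const[OF A0, of k] by (simp add: algebra_simps)
  qed
  have "crd (i + 2) (td_comm \<beta> \<gamma> \<rho> A As (vec i)) = 0"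
    by (simp add: A0 coord_zero)
  then have "\<phi> i - (\<beta> + 1) * \<phi> (i + 1) + (\<beta> + 1) * \<phi> (i + 2) - \<phi> (i + 3)
    + (\<theta>s i * (a (i + 1) + a (i + 2) + a (i + 3))
    - (\<beta> + 1) * (a (i + 1) * \<theta>s i + \<theta>s (i + 1) * (a (i + 2) + a (i + 3)))
    + (\<beta> + 1) * ((a (i + 1) + a (i + 2)) * \<theta>s (i + 1) + \<theta>s (i + 2) * a (i + 3))
    - \<theta>s (i + 2) * (a (i + 1) + a (i + 2) + a (i + 3))
    - \<gamma> * (\<theta>s i - \<theta>s (i + 2))) = 0"
    unfolding crd_td_comm_up2[OF i] d_diff by (simp only: add_diff_eq add.assoc[symmetric])
  then have \<phi>: "\<phi> i - (\<beta> + 1) * \<phi> (i + 1) + (\<beta> + 1) * \<phi> (i + 2) - \<phi> (i + 3)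
    + (\<beta> + 1) * (\<theta>s i * (a (i + 2) - a (i + 1)) + \<theta>s (i + 1) * (a (i + 1) - a (i + 3))
      + \<theta>s (i + 2) * (a (i + 3) - a (i + 2))) = 0"
    unfolding up2_identity[OF \<gamma>] .
  define a' where "a' k = a k - \<theta> 0" for k
  define b' where "b' k = \<theta>s k - \<theta>s 0" for k
  have ba: "b' i * a' i - (\<beta> + 1) * (b' (i + 1) * a' (i + 1)) + (\<beta> + 1) * (b' (i + 2) * a' (i + 2))
      - b' (i + 3) * a' (i + 3) =
    - ((\<beta> + 1) * (b' i * (a' (i + 2) - a' (i + 1)) + b' (i + 1) * (a' (i + 1) - a' (i + 3))
      + b' (i + 2) * (a' (i + 3) - a' (i + 2))))"
  proof (rule vartheta_identity)
    show "b' i = 0 \<or> a' i - (\<beta> + 1) * a' (i + 1) + (\<beta> + 1) * a' (i + 2) - a' (i + 3) = 0"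
    proof (cases "i = 0")
      case False
      then obtain j where j: "i = Suc j" by (cases i) auto
      have "a i - \<beta> * a (i + 1) + a (i + 2) = \<gamma>"
      proof -
        obtain k where "d = i + 2 + k" using i le_Suc_ex by blast
        then have "a i = \<theta> (k + 3)" "a (i + 1) = \<theta> (k + 2)" "a (i + 2) = \<theta> (k + 1)" "k + 3 \<le> d"
          using j by (simp_all add: a_def numeral_3_eq_3)
        then show ?thesis
          using A.td_comm_zero_const[OF A0, of "k + 1"]
          by (simp add: algebra_simps eval_nat_numeral)
      qed
      then have "a i - (\<beta> + 1) * a (i + 1) + (\<beta> + 1) * a (i + 2) - a (i + 3) = 0"
        using \<gamma> recurrence_step by blast
      then show ?thesis by (simp add: a'_def algebra_simps)
    qed (simp add: b'_def)
    show "a' (i + 3) = 0 \<or> b' i - (\<beta> + 1) * b' (i + 1) + (\<beta> + 1) * b' (i + 2) - b' (i + 3) = 0"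
    \<comment> \<open>Otherwise \<open>i + 3 = d + 1\<close>, where \<open>a'\<close> is zero by
      construction.\<close>
    proof (cases "i + 3 \<le> d")
      case True
      then have "\<theta>s i - (\<beta> + 1) * \<theta>s (i + 1) + (\<beta> + 1) * \<theta>s (i + 2) - \<theta>s (i + 3) = 0"
        using beta_recurrent_seq_const[OF As.td_comm_zero_const[OF As0]]
        by (simp add: beta_recurrent_seq_iff)
      then show ?thesis by (simp add: b'_def algebra_simps)
    next
      case False
      then show ?thesis by (simp add: a'_def a_def)
    qed
  qed
  have v: "vartheta k = \<phi> k - b' k * a' k" if "k \<le> Suc d" for k
    using vartheta_eq[OF that] by (simp add: a_def a'_def b'_def)
  have vartheta: "vartheta i - (\<beta> + 1) * vartheta (i + 1) + (\<beta> + 1) * vartheta (i + 2) - vartheta (i + 3) =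
    (\<phi> i - (\<beta> + 1) * \<phi> (i + 1) + (\<beta> + 1) * \<phi> (i + 2) - \<phi> (i + 3)) -
    (b' i * a' i - (\<beta> + 1) * (b' (i + 1) * a' (i + 1)) + (\<beta> + 1) * (b' (i + 2) * a' (i + 2))
      - b' (i + 3) * a' (i + 3))"
    using i by (simp add: v algebra_simps)
  \<comment> \<open>The sum involves only differences of \<open>a'\<close>, and these add up to
    zero, so both translations drop out.\<close>
  have shift: "(\<beta> + 1) * (b' i * (a' (i + 2) - a' (i + 1)) + b' (i + 1) * (a' (i + 1) - a' (i + 3))
      + b' (i + 2) * (a' (i + 3) - a' (i + 2))) =
    (\<beta> + 1) * (\<theta>s i * (a (i + 2) - a (i + 1)) + \<theta>s (i + 1) * (a (i + 1) - a (i + 3))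
      + \<theta>s (i + 2) * (a (i + 3) - a (i + 2)))"
    by (simp add: a'_def b'_def algebra_simps)
  show "vartheta i - (\<beta> + 1) * vartheta (i + 1) + (\<beta> + 1) * vartheta (i + 2)
      - vartheta (i + 3) = 0"
    unfolding vartheta ba shift using \<phi> by (simp only: diff_minus_eq_add)
qed

lemma beta_recurrent_iff:
  "beta_recurrent_seq \<beta> d \<theta> \<and> beta_recurrent_seq \<beta> d \<theta>s \<and> beta_recurrent_seq \<beta> (d + 1) vartheta \<longleftrightarrow>
    (\<exists>\<gamma> \<gamma>s \<rho> \<rho>s. td_comm \<beta> \<gamma> \<rho> A As = (\<lambda>v. 0) \<and> td_comm \<beta> \<gamma>s \<rho>s As A = (\<lambda>v. 0))"
proof
  assume "\<exists>\<gamma> \<gamma>s \<rho> \<rho>s. td_comm \<beta> \<gamma> \<rho> A As = (\<lambda>v. 0) \<and> td_comm \<beta> \<gamma>s \<rho>s As A = (\<lambda>v. 0)"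
  then obtain \<gamma> \<gamma>s \<rho> \<rho>s
    where 0: "td_comm \<beta> \<gamma> \<rho> A As = (\<lambda>v. 0)" "td_comm \<beta> \<gamma>s \<rho>s As A = (\<lambda>v. 0)"
    by blast
  show "beta_recurrent_seq \<beta> d \<theta> \<and> beta_recurrent_seq \<beta> d \<theta>s \<and> beta_recurrent_seq \<beta> (d + 1) vartheta"
    using beta_recurrent_seq_const[OF A.td_comm_zero_const[OF 0(1)]]
      beta_recurrent_seq_const[OF As.td_comm_zero_const[OF 0(2)]] beta_recurrent_vartheta[OF 0]
    by blast
qed (use td_comm_A_zero td_comm_As_zero in blast)

end

theorem proposition3p3:
  fixes scale :: "'a::field \<Rightarrow> 'b::ab_group_add \<Rightarrow> 'b"
    and d :: nat and \<beta> :: 'a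
    and A As :: "'b \<Rightarrow> 'b" and E Es :: "nat \<Rightarrow> 'b \<Rightarrow> 'b"
  assumes "vector_space scale"
    and "3 \<le> d"
    and "vector_space.dim scale (UNIV :: 'b set) = d + 1"
    and "vector_space.CH_system scale d A E As Es"
  shows "vector_space.beta_recurrent scale \<beta> d A E As Es \<longleftrightarrow>
    (\<exists>\<gamma> \<gamma>s \<rho> \<rho>s.
       commutator A
         (\<lambda>v. A (A (As v)) - scale \<beta> (A (As (A v))) + As (A (A v))
              - scale \<gamma> (A (As v) + As (A v)) - scale \<rho> (As v)) = (\<lambda>v. 0) \<and>
       commutator As
         (\<lambda>v. As (As (A v)) - scale \<beta> (As (A (As v))) + A (As (As v))
              - scale \<gamma>s (As (A v) + A (As v)) - scale \<rho>s (A v)) = (\<lambda>v. 0))"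
proof -
  interpret vector_space scale by fact
  have ch: "multiplicity_free A" "multiplicity_free As" "idempotent_ordering d A E"
    "idempotent_ordering d As Es" "circular_Hessenberg d E As" "circular_Hessenberg d Es A"
    using assms(4) by (simp_all add: CH_system_def)
  have dim: "dim UNIV = Suc d" using assms(3) by simp
  interpret A: spectral scale d A E "eigenvalue_seq A E"
    by (rule spectral_eigenvalue_seq[OF dim ch(1,3)])
  interpret As: spectral scale d As Es "eigenvalue_seq As Es"
    by (rule spectral_eigenvalue_seq[OF dim ch(2,4)])
  obtain x where "Es 0 x \<noteq> 0" using As.idem_nonzero[of 0] by auto
  then interpret split_basis scale d A E "eigenvalue_seq A E" As Es "eigenvalue_seq As Es" "Es 0 x"
    by unfold_locales (use assms(2) dim ch A.endo_map As.endo_map As.idem_idem[of 0 0] in auto)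
  obtain \<phi> where \<phi>: "\<And>i. i \<in> {1..d} \<Longrightarrow> \<phi> i \<noteq> 0" "\<And>i. i \<notin> {1..d} \<Longrightarrow> \<phi> i = 0"
    "\<And>i. As (vec i) = scale (eigenvalue_seq As Es i) (vec i) + scale (\<phi> i) (vec (i - 1))"
    using ex_split_coeffs by blast
  interpret split_coeffs scale d A E "eigenvalue_seq A E" As Es "eigenvalue_seq As Es" "Es 0 x" \<phi>
    by unfold_locales (fact \<phi>)+
  have "is_split_seq d A E As Es \<phi>"
    unfolding is_split_seq_iff using \<phi>(1,3) basis A_vec vec_zero[of "Suc d"] \<phi>(2)[of 0]
    by (intro conjI exI[of _ vec]) (auto simp: le_less simp del: vec.simps)
  \<comment> \<open>Within \<open>{1..d}\<close> the coefficients are unique; outside, both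
    functions are normalised to \<open>0\<close>.\<close>
  moreover have "\<psi> = \<phi>"
    if \<psi>: "is_split_seq d A E As Es \<psi>" "\<forall>i. i \<notin> {1..d} \<longrightarrow> \<psi> i = 0" for \<psi>
  proof
    fix i
    show "\<psi> i = \<phi> i"
    proof (cases "i \<in> {1..d}")
      case True
      then show ?thesis
        using \<psi>(1) split_coeffs_unique[OF \<phi>(3)] unfolding is_split_seq_iff by blast
    qed (use \<psi>(2) \<phi>(2) in simp)
  qed
  ultimately have "split_seq d A E As Es = \<phi>"
    unfolding split_seq_def using \<phi>(2) by (intro the_equality) blast+
  then have "vartheta_seq d A E As Es = vartheta"
    by (simp add: fun_eq_iff vartheta_seq_def vartheta_def)
  then show ?thesis
    using beta_recurrent_iff by (simp add: beta_recurrent_def td_comm_def)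
qed

end
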